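(* Let $\delta\in(0,1)$, $\epsilon\in(0,1)$ with $\epsilon<\delta$, and $p=0$. Let $X\sim(1-\epsilon)\Delta_0+\epsilon G$ and $U\sim G$, where $G$ is a probability distribution on $\mathbb{R}$ with $\mathbb{E}|U|^2<\infty$ and $P(|U|>\mu)=1$, where $\mu=\sup\{v:P(|U|>v)=1\}>0$. For each $\sigma_w>0$ let $\sigma_\ell$ be the lowest fixed point of $\Psi_{\lambda_*,0}(\sigma^2)$, i.e. the smallest $\sigma\ge0$ with $\Psi_{\lambda_*,0}(\sigma^2)=\sigma^2$. Then, as $\sigma_w\to0$, $$\sigma_\ell^2=\frac{\delta}{\delta-\epsilon}\sigma_w^2+o\left(\phi(\bar\mu\,\sigma_w^{-1})\right)$$ for every constant $\bar\mu$ with $0<\bar\mu<\frac{\mu}{2}\sqrt{\frac{\delta-\epsilon}{\delta}}$.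
   Context: $\Delta_a$ denotes the point mass at $a$ and $\phi$ the standard normal density. Hard thresholding: $\eta_0(u;\lambda)=u\,\mathbb{I}(|u|>\sqrt{2\lambda})$ for $\lambda\ge0$. State evolution map with optimal thresholding policy: for $\sigma\ge0$, $$\Psi_{\lambda_*,0}(\sigma^2)=\sigma_w^2+\frac1\delta\inf_{\lambda\ge0}\mathbb{E}\left|\eta_0(X+\sigma Z;\lambda)-X\right|^2,$$ with $X$ and $Z\sim N(0,1)$ independent. *)

theory Defs
  imports "HOL-Probability.Probability"
begin

definition point_mass_mixture :: "real \<Rightarrow> real measure \<Rightarrow> real measure" where
  "point_mass_mixture \<epsilon> G =
     measure_of UNIV (sets borel)
       (\<lambda>A. ennreal (1 - \<epsilon>) * emeasure (return borel 0) A + ennreal \<epsilon> * emeasure G A)"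

lemma sets_point_mass_mixture [simp]: "sets (point_mass_mixture \<epsilon> G) = sets borel"
  and space_point_mass_mixture [simp]: "space (point_mass_mixture \<epsilon> G) = UNIV"
  
  using sets.sigma_sets_eq[of "borel :: real measure"]
  by (simp_all add: point_mass_mixture_def sets_measure_of_conv space_measure_of_conv)

text \<open>The set function above is countably additive, so \<^const>\<open>measure_of\<close> does not
  collapse to the zero measure.\<close>

lemma emeasure_point_mass_mixture:
  assumes "sets G = sets borel" and A: "A \<in> sets borel"
  shows "emeasure (point_mass_mixture \<epsilon> G) A =
    ennreal (1 - \<epsilon>) * indicator A 0 + ennreal \<epsilon> * emeasure G A"
proof -
  let ?f = "\<lambda>A. ennreal (1 - \<epsilon>) * emeasure (return borel (0::real)) A + ennreal \<epsilon> * emeasure G A"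
  have "countably_additive (sets borel) ?f"
  proof (rule countably_additiveI)
    fix F :: "nat \<Rightarrow> real set"
    assume F: "range F \<subseteq> sets borel" "disjoint_family F"
    have "(\<Sum>i. emeasure (return borel (0::real)) (F i)) = emeasure (return borel 0) (\<Union>i. F i)"
      using F by (intro suminf_emeasure) auto
    moreover have "(\<Sum>i. emeasure G (F i)) = emeasure G (\<Union>i. F i)"
      using F assms(1) by (intro suminf_emeasure) auto
    ultimately show "(\<Sum>i. ?f (F i)) = ?f (\<Union>i. F i)"
      by (simp add: suminf_add[symmetric])
  qed
  moreover have "positive (sets borel) ?f"
    by (simp add: positive_def)
  moreover have "sigma_algebra UNIV (sets (borel :: real measure))"
    using sets.sigma_algebra_axioms[of "borel :: real measure"] by simp
  ultimately have "emeasure (point_mass_mixture \<epsilon> G) A = ?f A"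
    unfolding point_mass_mixture_def using A by (intro emeasure_measure_of_sigma)
  then show ?thesis
    using A by simp
qed

definition hard_threshold :: "real \<Rightarrow> real \<Rightarrow> real" where
  "hard_threshold u l = u * of_bool (\<bar>u\<bar> > sqrt (2 * l))"

text \<open>The argument \<open>s\<close> of \<open>state_evolution\<close> is the variance \<open>\<sigma>\<^sup>2\<close>, hence \<open>sqrt s\<close> below.\<close>

definition state_evolution ::
  "'a measure \<Rightarrow> ('a \<Rightarrow> real) \<Rightarrow> ('a \<Rightarrow> real) \<Rightarrow> real \<Rightarrow> real \<Rightarrow> real \<Rightarrow> real" where
  "state_evolution M X Z \<delta> \<sigma>w s =
     \<sigma>w\<^sup>2 + 1 / \<delta> *
       (INF l\<in>{0..}. prob_space.expectation M
          (\<lambda>\<omega>. \<bar>hard_threshold (X \<omega> + sqrt s * Z \<omega>) l - X \<omega>\<bar>\<^sup>2))"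

definition lowest_fixed_point :: "(real \<Rightarrow> real) \<Rightarrow> real" where
  "lowest_fixed_point \<Psi> = (LEAST \<sigma>. \<sigma> \<ge> 0 \<and> \<Psi> (\<sigma>\<^sup>2) = \<sigma>\<^sup>2)"

end

theory Submission
  imports Defs "HOL-Real_Asymp.Real_Asymp"
begin

text \<open>
  Write the risk as \<open>E[\<sigma>\<^sup>2 Z\<^sup>2; |X + \<sigma> Z| > \<tau>] + E[X\<^sup>2; |X + \<sigma> Z| \<le> \<tau>]\<close>. Since \<open>X\<close> is either zero or
  larger than \<open>\<mu>\<close> in absolute value, the loss at \<open>\<tau> = \<mu>/2\<close> differs from \<open>\<sigma>\<^sup>2 Z\<^sup>2 1(X \<noteq> 0)\<close> only when
  \<open>\<sigma>|Z| \<ge> \<mu>/2\<close>, and for an arbitrary threshold the loss can be smaller than this only on the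
  same event. A Chernoff bound therefore shows that the optimal risk is
  \<open>\<epsilon> \<sigma>\<^sup>2 + O(exp(- t \<mu>\<^sup>2 / (8 \<sigma>\<^sup>2)))\<close> for every \<open>t < 1\<close>. Integrating against the density of \<open>\<sigma> Z\<close>
  shows that the risk is continuous in \<open>\<sigma> > 0\<close> uniformly in the threshold, so the optimal risk is
  continuous. The intermediate value theorem now yields a fixed point, and hence a lowest one,
  with \<open>\<sigma>\<^sup>2 \<le> \<delta> \<sigma>\<^sub>w\<^sup>2 / ((\<delta> - \<epsilon>) t)\<close>; inserting this into the estimate of the risk gives the claim.
\<close>

section \<open>Infima, Gaussian densities of varying scale, hard thresholding and least fixed
  points\<close>

lemma INF_le_INF_plus:
  fixes f g :: "'i \<Rightarrow> real"
  assumes "A \<noteq> {}" "bdd_below (f ` A)" "\<And>i. i \<in> A \<Longrightarrow> f i \<le> g i + d"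
  shows "(INF i\<in>A. f i) \<le> (INF i\<in>A. g i) + d"
proof -
  have "(INF i\<in>A. f i) - d \<le> (INF i\<in>A. g i)"
  proof (rule cINF_greatest[OF assms(1)])
    fix i assume "i \<in> A"
    with cINF_lower[OF assms(2), of i] assms(3)[of i] show "(INF i\<in>A. f i) - d \<le> g i"
      by linarith
  qed
  then show ?thesis by simp
qed

text \<open>Over scales in \<open>{a..b}\<close> the exponential factor is largest at
  \<open>b\<close> and the prefactor at \<open>a\<close>. This gives one integrable majorant for a
  whole compact range of scales.\<close>

lemma normal_density_le_scaled:
  assumes "0 < a" "a \<le> s" "s \<le> b"
  shows "normal_density 0 s w \<le> b / a * normal_density 0 b w"
proof -
  have "w\<^sup>2 / (2 * b\<^sup>2) \<le> w\<^sup>2 / (2 * s\<^sup>2)"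
    using assms by (intro divide_left_mono mult_left_mono power_mono) auto
  then have "exp (- (w\<^sup>2) / (2 * s\<^sup>2)) \<le> exp (- (w\<^sup>2) / (2 * b\<^sup>2))"
    by simp
  moreover have "1 / (sqrt (2 * pi) * s) \<le> 1 / (sqrt (2 * pi) * a)"
    using assms by (intro divide_left_mono mult_left_mono) auto
  ultimately have "1 / (sqrt (2 * pi) * s) * exp (- (w\<^sup>2) / (2 * s\<^sup>2))
      \<le> 1 / (sqrt (2 * pi) * a) * exp (- (w\<^sup>2) / (2 * b\<^sup>2))"
    using assms by (intro mult_mono) auto
  with assms show ?thesis
    by (simp add: normal_density_def real_sqrt_mult field_simps)
qed

lemma continuous_on_normal_density_scale:
  "continuous_on {0<..} (\<lambda>s. normal_density m s w)"
  unfolding normal_density_def by (intro continuous_intros) auto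

lemma integrable_normal_density_second_moment:
  assumes "0 < s"
  shows "integrable lborel (\<lambda>w. normal_density 0 s w * (w\<^sup>2 + c))"
  using assms integrable_normal_moment[OF assms, of 0 2]
  unfolding distrib_left
  by (intro Bochner_Integration.integrable_add integrable_mult_left) auto

text \<open>Dominated convergence: the densities converge pointwise, and a multiple of the widest
  one is the majorant. The weight mirrors the bound \<open>w\<^sup>2 + x\<^sup>2\<close> on the
  loss; later \<open>c\<close> is the second moment of \<open>X\<close>.\<close>

lemma tendsto_normal_density_weighted_L1:
  assumes a: "0 < a" and s: "s \<in> {a..b}" and v: "\<And>n. v n \<in> {a..b}" and lim: "v \<longlonglongrightarrow> s"
    and c: "0 \<le> c"
  shows "(\<lambda>n. \<integral>w. \<bar>normal_density 0 (v n) w - normal_density 0 s w\<bar> * (w\<^sup>2 + c) \<partial>lborel) \<longlonglongrightarrow> 0"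
proof -
  have "(\<lambda>n. \<integral>w. \<bar>normal_density 0 (v n) w - normal_density 0 s w\<bar> * (w\<^sup>2 + c) \<partial>lborel)
      \<longlonglongrightarrow> (\<integral>w. 0 \<partial>(lborel :: real measure))"
  proof (rule integral_dominated_convergence)
    show "integrable lborel (\<lambda>w. 2 * (b / a) * (normal_density 0 b w * (w\<^sup>2 + c)))"
      using a s by (intro integrable_mult_right integrable_normal_density_second_moment) auto
    show "AE w in lborel. (\<lambda>n. \<bar>normal_density 0 (v n) w - normal_density 0 s w\<bar> * (w\<^sup>2 + c)) \<longlonglongrightarrow> 0"
    proof (rule AE_I2)
      fix w
      have "(\<lambda>n. normal_density 0 (v n) w) \<longlonglongrightarrow> normal_density 0 s w"
        using a s v
        by (intro continuous_on_tendsto_compose[OF continuous_on_normal_density_scale lim])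
           (auto simp: eventually_sequentially less_le_trans[OF a])
      from tendsto_mult_left_zero[OF tendsto_rabs_zero[OF LIM_zero[OF this]], of "w\<^sup>2 + c"]
      show "(\<lambda>n. \<bar>normal_density 0 (v n) w - normal_density 0 s w\<bar> * (w\<^sup>2 + c)) \<longlonglongrightarrow> 0" .
    qed
    show "AE w in lborel. norm (\<bar>normal_density 0 (v n) w - normal_density 0 s w\<bar> * (w\<^sup>2 + c))
        \<le> 2 * (b / a) * (normal_density 0 b w * (w\<^sup>2 + c))" for n
    proof (rule AE_I2)
      fix w
      have "normal_density 0 (v n) w \<le> b / a * normal_density 0 b w"
           "normal_density 0 s w \<le> b / a * normal_density 0 b w"
        using a s v[of n] by (intro normal_density_le_scaled; simp)+
      then have "\<bar>normal_density 0 (v n) w - normal_density 0 s w\<bar> \<le> 2 * (b / a) * normal_density 0 b w"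
        using normal_density_nonneg[of 0 "v n" w] normal_density_nonneg[of 0 s w] by linarith
      then have "\<bar>normal_density 0 (v n) w - normal_density 0 s w\<bar> * (w\<^sup>2 + c)
          \<le> 2 * (b / a) * normal_density 0 b w * (w\<^sup>2 + c)"
        using c by (intro mult_right_mono) auto
      then show "norm (\<bar>normal_density 0 (v n) w - normal_density 0 s w\<bar> * (w\<^sup>2 + c))
          \<le> 2 * (b / a) * (normal_density 0 b w * (w\<^sup>2 + c))"
        using c by (simp add: abs_mult mult.assoc)
    qed
  qed measurable
  then show ?thesis by simp
qed

text \<open>A kept observation leaves the noise as error, a discarded one leaves the signal.\<close>

lemma hard_threshold_loss:
  "(hard_threshold (x + w) l - x)\<^sup>2 = (if \<bar>x + w\<bar> > sqrt (2 * l) then w\<^sup>2 else x\<^sup>2)"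
  by (simp add: hard_threshold_def)

lemma hard_threshold_loss_le: "(hard_threshold (x + w) l - x)\<^sup>2 \<le> w\<^sup>2 + x\<^sup>2"
  unfolding hard_threshold_loss by simp

lemma borel_measurable_hard_threshold [measurable]:
  "(\<lambda>u. hard_threshold u l) \<in> borel_measurable borel"
  unfolding hard_threshold_def by measurable

text \<open>The intermediate value theorem makes the set of fixed points in \<open>{a..b}\<close>
  nonempty, and continuity makes it compact, so its minimum is attained. As nothing below
  \<open>a\<close> is a fixed point, this minimum is the value of \<open>LEAST\<close>.\<close>

lemma lowest_fixed_pointI:
  assumes cont: "continuous_on {a..b} (\<lambda>\<sigma>. \<Psi> (\<sigma>\<^sup>2) - \<sigma>\<^sup>2)"
    and "0 \<le> a" "a \<le> b" "\<Psi> (b\<^sup>2) \<le> b\<^sup>2"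
    and below: "\<And>\<sigma>. 0 \<le> \<sigma> \<Longrightarrow> \<sigma> < a \<Longrightarrow> \<Psi> (\<sigma>\<^sup>2) > \<sigma>\<^sup>2" and "\<Psi> (a\<^sup>2) \<ge> a\<^sup>2"
  shows "lowest_fixed_point \<Psi> \<in> {a..b}"
    and "\<Psi> ((lowest_fixed_point \<Psi>)\<^sup>2) = (lowest_fixed_point \<Psi>)\<^sup>2"
proof -
  define S where "S = {\<sigma> \<in> {a..b}. \<Psi> (\<sigma>\<^sup>2) - \<sigma>\<^sup>2 = 0}"
  have "\<exists>x. a \<le> x \<and> x \<le> b \<and> \<Psi> (x\<^sup>2) - x\<^sup>2 = 0"
    using assms by (intro IVT2') auto
  then have ne: "S \<noteq> {}" by (auto simp: S_def)
  have "closed S"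
    unfolding S_def using cont by (intro continuous_closed_preimage_constant) auto
  then have "compact ({a..b} \<inter> S)" by (intro compact_Int_closed) auto
  moreover have "{a..b} \<inter> S = S" by (auto simp: S_def)
  ultimately obtain x where x: "x \<in> S" "\<And>y. y \<in> S \<Longrightarrow> x \<le> y"
    using compact_attains_inf[of S] ne by auto
  have "lowest_fixed_point \<Psi> = x"
    unfolding lowest_fixed_point_def
  proof (rule Least_equality)
    show "0 \<le> x \<and> \<Psi> (x\<^sup>2) = x\<^sup>2" using x assms by (auto simp: S_def)
    fix y assume y: "0 \<le> y \<and> \<Psi> (y\<^sup>2) = y\<^sup>2"
    then have "a \<le> y" using below[of y] by force
    show "x \<le> y"
    proof (cases "y \<le> b")
      case True
      with \<open>a \<le> y\<close> y have "y \<in> S" by (auto simp: S_def)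
      then show ?thesis by (rule x(2))
    next
      case False
      then show ?thesis using x(1) by (auto simp: S_def)
    qed
  qed
  with x(1) show "lowest_fixed_point \<Psi> \<in> {a..b}"
    "\<Psi> ((lowest_fixed_point \<Psi>)\<^sup>2) = (lowest_fixed_point \<Psi>)\<^sup>2"
    by (auto simp: S_def)
qed

section \<open>The channel, with \<open>X\<close> known through its second moment, its gap around 0
  and its sparsity\<close>

locale sparse_gaussian_channel = prob_space M for M :: "'a measure" +
  fixes X Z :: "'a \<Rightarrow> real" and \<epsilon> \<mu> :: real
  assumes X_meas [measurable]: "random_variable borel X"
    and Z_dist: "distributed M lborel Z std_normal_density"
    and indep: "indep_var borel X borel Z"
    and X_sq: "integrable M (\<lambda>\<omega>. (X \<omega>)\<^sup>2)"
    and X_gap: "AE \<omega> in M. X \<omega> = 0 \<or> \<bar>X \<omega>\<bar> > \<mu>"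
    and X_sparse: "prob {\<omega> \<in> space M. X \<omega> \<noteq> 0} = \<epsilon>"
    and \<mu>_pos: "0 < \<mu>"
begin

text \<open>The argument is the noise scale, whereas \<open>state_evolution\<close> takes the
  variance.\<close>

definition risk :: "real \<Rightarrow> real \<Rightarrow> real" where
  "risk \<sigma> l = expectation (\<lambda>\<omega>. (hard_threshold (X \<omega> + \<sigma> * Z \<omega>) l - X \<omega>)\<^sup>2)"

definition opt_risk :: "real \<Rightarrow> real" where
  "opt_risk \<sigma> = (INF l\<in>{0..}. risk \<sigma> l)"

lemma state_evolution_eq:
  "0 \<le> \<sigma> \<Longrightarrow> state_evolution M X Z \<delta> \<sigma>w (\<sigma>\<^sup>2) = \<sigma>w\<^sup>2 + 1 / \<delta> * opt_risk \<sigma>"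
  unfolding state_evolution_def opt_risk_def risk_def by simp

lemma Z_meas [measurable]: "random_variable borel Z"
  using distributed_measurable[OF Z_dist] by simp

lemma integrable_Z: "g \<in> borel_measurable borel \<Longrightarrow>
    integrable M (\<lambda>\<omega>. g (Z \<omega>)) \<longleftrightarrow> integrable lborel (\<lambda>z. std_normal_density z * g z)"
  using distributed_integrable[OF Z_dist, of g] by simp

lemma Z_sq: "integrable M (\<lambda>\<omega>. (Z \<omega>)\<^sup>2)"
  using integrable_Z[of "\<lambda>z. z\<^sup>2"] integrable_std_normal_moment[of 2] by simp

lemma expectation_Z_sq: "expectation (\<lambda>\<omega>. (Z \<omega>)\<^sup>2) = 1"
  using distributed_integral[OF Z_dist, of "\<lambda>z. z\<^sup>2"] integral_std_normal_moment_even[of 1] by simp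

lemma indep_function_product:
  assumes [measurable]: "f \<in> borel_measurable borel" "g \<in> borel_measurable borel"
    and "integrable M (\<lambda>\<omega>. f (X \<omega>))" "integrable M (\<lambda>\<omega>. g (Z \<omega>))"
  shows "integrable M (\<lambda>\<omega>. f (X \<omega>) * g (Z \<omega>) :: real)"
    and "expectation (\<lambda>\<omega>. f (X \<omega>) * g (Z \<omega>))
      = expectation (\<lambda>\<omega>. f (X \<omega>)) * expectation (\<lambda>\<omega>. g (Z \<omega>))"
proof -
  have "indep_var borel (\<lambda>\<omega>. f (X \<omega>)) borel (\<lambda>\<omega>. g (Z \<omega>))"
    using indep_var_compose[OF indep, of f borel g borel] by (simp add: comp_def)
  then show "integrable M (\<lambda>\<omega>. f (X \<omega>) * g (Z \<omega>))"
    "expectation (\<lambda>\<omega>. f (X \<omega>) * g (Z \<omega>))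
      = expectation (\<lambda>\<omega>. f (X \<omega>)) * expectation (\<lambda>\<omega>. g (Z \<omega>))"
    using assms by (auto intro: indep_var_integrable indep_var_lebesgue_integral)
qed

lemma integrable_loss: "integrable M (\<lambda>\<omega>. (hard_threshold (X \<omega> + \<sigma> * Z \<omega>) l - X \<omega>)\<^sup>2)"
proof (rule Bochner_Integration.integrable_bound)
  show "integrable M (\<lambda>\<omega>. \<sigma>\<^sup>2 * (Z \<omega>)\<^sup>2 + (X \<omega>)\<^sup>2)"
    using Z_sq X_sq by simp
  show "AE \<omega> in M. norm ((hard_threshold (X \<omega> + \<sigma> * Z \<omega>) l - X \<omega>)\<^sup>2)
      \<le> norm (\<sigma>\<^sup>2 * (Z \<omega>)\<^sup>2 + (X \<omega>)\<^sup>2)"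
    using hard_threshold_loss_le[of "X _" "\<sigma> * Z _" l] by (intro AE_I2) (simp add: power_mult_distrib)
qed measurable

lemma risk_nonneg: "0 \<le> risk \<sigma> l"
  unfolding risk_def by simp

lemma bdd_below_risk: "bdd_below (risk \<sigma> ` A)"
  by (rule bdd_belowI2[where m = 0]) (rule risk_nonneg)

lemma opt_risk_nonneg: "0 \<le> opt_risk \<sigma>"
  unfolding opt_risk_def by (rule cINF_greatest) (auto intro: risk_nonneg)

lemma opt_risk_le: "0 \<le> l \<Longrightarrow> opt_risk \<sigma> \<le> risk \<sigma> l"
  unfolding opt_risk_def by (rule cINF_lower) (auto intro: bdd_below_risk)

subsection \<open>The optimal risk at small noise levels\<close>

text \<open>The polynomial factors dominate
  \<open>(X \<omega>)\<^sup>2 + (Z \<omega>)\<^sup>2\<close>, and the exponential is the Chernoff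
  tilt for a tail event of \<open>Z\<close>. The noise scale does not occur, so the expectation is a
  constant as the noise vanishes.\<close>

definition chernoff_weight :: "real \<Rightarrow> 'a \<Rightarrow> real" where
  "chernoff_weight t \<omega> = (1 + (X \<omega>)\<^sup>2) * ((1 + (Z \<omega>)\<^sup>2) * exp (t * (Z \<omega>)\<^sup>2 / 2))"

text \<open>Tilting the standard normal density by \<open>exp (t * z\<^sup>2 / 2)\<close> gives a
  multiple of the centred normal density of variance \<open>1 / (1 - t)\<close>, which has a second
  moment. Independence then separates the factor in \<open>X\<close>.\<close>

lemma integrable_chernoff_weight:
  assumes "t < 1"
  shows "integrable M (chernoff_weight t)"
proof -
  define s where "s = 1 / sqrt (1 - t)"
  have s: "s > 0" "s\<^sup>2 = 1 / (1 - t)"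
    using assms by (auto simp: s_def power_divide)
  have "std_normal_density z * ((1 + z\<^sup>2) * exp (t * z\<^sup>2 / 2)) = s * (normal_density 0 s z * (z\<^sup>2 + 1))" for z
  proof -
    have "exp (- z\<^sup>2 / 2) * exp (t * z\<^sup>2 / 2) = exp (- (z\<^sup>2) / (2 * s\<^sup>2))"
      unfolding exp_add[symmetric] using assms by (simp add: s field_simps)
    moreover have "normal_density 0 s z = 1 / (sqrt (2 * pi) * s) * exp (- (z\<^sup>2) / (2 * s\<^sup>2))"
      using s(1) by (simp add: normal_density_def real_sqrt_mult)
    ultimately show ?thesis
      using s(1) by (simp add: std_normal_density_def field_simps)
  qed
  then have "integrable lborel (\<lambda>z. std_normal_density z * ((1 + z\<^sup>2) * exp (t * z\<^sup>2 / 2)))"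
    using integrable_normal_density_second_moment[OF s(1), of 1] by simp
  then have "integrable M (\<lambda>\<omega>. (1 + (Z \<omega>)\<^sup>2) * exp (t * (Z \<omega>)\<^sup>2 / 2))"
    by (subst integrable_Z[of "\<lambda>z. (1 + z\<^sup>2) * exp (t * z\<^sup>2 / 2)"]) auto
  then have "integrable M (\<lambda>\<omega>. (1 + (X \<omega>)\<^sup>2) * ((1 + (Z \<omega>)\<^sup>2) * exp (t * (Z \<omega>)\<^sup>2 / 2)))"
    using X_sq
    by (intro indep_function_product(1)[of "\<lambda>x. 1 + x\<^sup>2" "\<lambda>z. (1 + z\<^sup>2) * exp (t * z\<^sup>2 / 2)"]) auto
  then show ?thesis unfolding chernoff_weight_def[abs_def] .
qed

lemma chernoff_weight_nonneg: "0 \<le> chernoff_weight t \<omega>"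
  unfolding chernoff_weight_def by simp

text \<open>On the tail event \<open>(Z \<omega>)\<^sup>2 / 2\<close> is at least
  \<open>\<mu>\<^sup>2 / (8 * \<sigma>\<^sup>2)\<close>, so the two exponentials multiply to at
  least 1. The bound \<open>\<sigma> \<le> 1\<close> removes the noise scale from the polynomial
  part.\<close>

lemma tail_le_chernoff:
  assumes \<sigma>: "0 < \<sigma>" "\<sigma> \<le> 1" and t: "0 \<le> t" and tail: "\<mu> / 2 \<le> \<sigma> * \<bar>Z \<omega>\<bar>"
  shows "(\<sigma> * Z \<omega>)\<^sup>2 + (X \<omega>)\<^sup>2 \<le> chernoff_weight t \<omega> * exp (- t * \<mu>\<^sup>2 / (8 * \<sigma>\<^sup>2))"
proof -
  have "(\<mu> / 2)\<^sup>2 \<le> (\<sigma> * \<bar>Z \<omega>\<bar>)\<^sup>2"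
    using tail \<mu>_pos by (intro power_mono) auto
  then have "\<mu>\<^sup>2 / 4 / (2 * \<sigma>\<^sup>2) \<le> \<sigma>\<^sup>2 * (Z \<omega>)\<^sup>2 / (2 * \<sigma>\<^sup>2)"
    by (intro divide_right_mono) (auto simp: power_mult_distrib power_divide)
  then have "\<mu>\<^sup>2 / (8 * \<sigma>\<^sup>2) \<le> (Z \<omega>)\<^sup>2 / 2"
    using \<sigma> by simp
  then have "t * (\<mu>\<^sup>2 / (8 * \<sigma>\<^sup>2)) \<le> t * ((Z \<omega>)\<^sup>2 / 2)"
    using t by (rule mult_left_mono)
  then have "1 \<le> exp (t * (Z \<omega>)\<^sup>2 / 2) * exp (- t * \<mu>\<^sup>2 / (8 * \<sigma>\<^sup>2))"
    unfolding exp_add[symmetric] by simp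
  then have "(1 + (X \<omega>)\<^sup>2) * (1 + (Z \<omega>)\<^sup>2) * 1
      \<le> (1 + (X \<omega>)\<^sup>2) * (1 + (Z \<omega>)\<^sup>2) * (exp (t * (Z \<omega>)\<^sup>2 / 2) * exp (- t * \<mu>\<^sup>2 / (8 * \<sigma>\<^sup>2)))"
    by (intro mult_left_mono) auto
  moreover have "(\<sigma> * Z \<omega>)\<^sup>2 \<le> (Z \<omega>)\<^sup>2"
    using \<sigma> by (simp add: power_mult_distrib mult_left_le_one_le power_le_one)
  moreover have "(Z \<omega>)\<^sup>2 + (X \<omega>)\<^sup>2 \<le> (1 + (X \<omega>)\<^sup>2) * (1 + (Z \<omega>)\<^sup>2)"
    by (simp add: algebra_simps)
  ultimately show ?thesis
    by (simp add: chernoff_weight_def mult_ac)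
qed

text \<open>The main term of the optimal risk: noise passed on exactly where the signal is nonzero.
  Its expectation factors by independence.\<close>

lemma signal_part:
  "integrable M (\<lambda>\<omega>. of_bool (X \<omega> \<noteq> 0) * (\<sigma> * Z \<omega>)\<^sup>2)"
  "expectation (\<lambda>\<omega>. of_bool (X \<omega> \<noteq> 0) * (\<sigma> * Z \<omega>)\<^sup>2) = \<epsilon> * \<sigma>\<^sup>2"
proof -
  have int: "integrable M (\<lambda>\<omega>. of_bool (X \<omega> \<noteq> 0) :: real)"
    by (rule integrable_const_bound[where B = 1]) auto
  have "expectation (\<lambda>\<omega>. of_bool (X \<omega> \<noteq> 0)) = expectation (indicator {\<omega> \<in> space M. X \<omega> \<noteq> 0})"
    by (intro Bochner_Integration.integral_cong) (auto simp: indicator_def)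
  also have "\<dots> = \<epsilon>"
    using X_sparse by simp
  finally have P: "expectation (\<lambda>\<omega>. of_bool (X \<omega> \<noteq> 0)) = \<epsilon>" .
  show "integrable M (\<lambda>\<omega>. of_bool (X \<omega> \<noteq> 0) * (\<sigma> * Z \<omega>)\<^sup>2)"
    using int Z_sq
    by (intro indep_function_product(1)[of "\<lambda>x. of_bool (x \<noteq> 0)" "\<lambda>z. (\<sigma> * z)\<^sup>2"])
       (auto simp: power_mult_distrib)
  show "expectation (\<lambda>\<omega>. of_bool (X \<omega> \<noteq> 0) * (\<sigma> * Z \<omega>)\<^sup>2) = \<epsilon> * \<sigma>\<^sup>2"
    using int Z_sq P expectation_Z_sq
    by (subst indep_function_product(2)[of "\<lambda>x. of_bool (x \<noteq> 0)" "\<lambda>z. (\<sigma> * z)\<^sup>2"])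
       (auto simp: power_mult_distrib)
qed

text \<open>Pointwise comparison of the loss with \<open>sig\<close>, with \<open>err\<close> paying
  for the event that the noise reaches \<open>\<mu> / 2\<close>. One well-chosen threshold gives the
  upper bound; the lower bound holds for every threshold.\<close>

lemma opt_risk_estimate:
  assumes t: "0 \<le> t" "t < 1" and \<sigma>: "0 < \<sigma>" "\<sigma> \<le> 1"
  shows "\<bar>opt_risk \<sigma> - \<epsilon> * \<sigma>\<^sup>2\<bar> \<le> expectation (chernoff_weight t) * exp (- t * \<mu>\<^sup>2 / (8 * \<sigma>\<^sup>2))"
proof -
  define err where "err \<omega> = chernoff_weight t \<omega> * exp (- t * \<mu>\<^sup>2 / (8 * \<sigma>\<^sup>2))" for \<omega>
  define loss where "loss l \<omega> = (hard_threshold (X \<omega> + \<sigma> * Z \<omega>) l - X \<omega>)\<^sup>2" for l \<omega>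
  define sig where "sig \<omega> = of_bool (X \<omega> \<noteq> 0) * (\<sigma> * Z \<omega>)\<^sup>2" for \<omega>
  have int_err: "integrable M err"
    unfolding err_def using integrable_chernoff_weight[OF t(2)] by simp
  have E_err: "expectation err = expectation (chernoff_weight t) * exp (- t * \<mu>\<^sup>2 / (8 * \<sigma>\<^sup>2))"
    unfolding err_def by simp
  have int_sig: "integrable M sig" and E_sig: "expectation sig = \<epsilon> * \<sigma>\<^sup>2"
    unfolding sig_def by (rule signal_part)+
  have err_nonneg: "0 \<le> err \<omega>" for \<omega>
    unfolding err_def by (simp add: chernoff_weight_nonneg)
  have tail: "(\<sigma> * Z \<omega>)\<^sup>2 + (X \<omega>)\<^sup>2 \<le> err \<omega>" if "\<mu> / 2 \<le> \<sigma> * \<bar>Z \<omega>\<bar>" for \<omega>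
    unfolding err_def using tail_le_chernoff[OF \<sigma> t(1) that] .
  have abs_noise: "\<bar>\<sigma> * Z \<omega>\<bar> = \<sigma> * \<bar>Z \<omega>\<bar>" for \<omega>
    using \<sigma> by (simp add: abs_mult)
  have "risk \<sigma> (\<mu>\<^sup>2 / 8) \<le> expectation (\<lambda>\<omega>. sig \<omega> + err \<omega>)"
    unfolding risk_def loss_def[symmetric]
  proof (rule integral_mono_AE)
    show "integrable M (loss (\<mu>\<^sup>2 / 8))" unfolding loss_def by (rule integrable_loss)
    \<comment> \<open>The parameter \<open>\<mu>\<^sup>2 / 8\<close> places the threshold at
      \<open>\<mu> / 2\<close>, halfway between 0 and the edge of the gap.\<close>
    have thr: "sqrt (2 * (\<mu>\<^sup>2 / 8)) = \<mu> / 2"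
      using \<mu>_pos by (intro real_sqrt_unique) (auto simp: power_divide)
    show "AE \<omega> in M. loss (\<mu>\<^sup>2 / 8) \<omega> \<le> sig \<omega> + err \<omega>"
      using X_gap
    proof eventually_elim
      case (elim \<omega>)
      show ?case
      proof (cases "\<mu> / 2 \<le> \<sigma> * \<bar>Z \<omega>\<bar>")
        case True
        have "loss (\<mu>\<^sup>2 / 8) \<omega> \<le> err \<omega>"
          using hard_threshold_loss_le[of "X \<omega>" "\<sigma> * Z \<omega>"] tail[OF True]
          unfolding loss_def by (rule order_trans)
        moreover have "0 \<le> sig \<omega>" by (simp add: sig_def)
        ultimately show ?thesis by simp
      next
        case False
        have "loss (\<mu>\<^sup>2 / 8) \<omega> \<le> sig \<omega>"
        proof (cases "X \<omega> = 0")
          case True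
          with False abs_noise[of \<omega>] show ?thesis
            unfolding loss_def hard_threshold_loss thr by (simp add: sig_def)
        next
          case nz: False
          \<comment> \<open>Noise below \<open>\<mu> / 2\<close> cannot push a signal larger than
            \<open>\<mu>\<close> under the threshold, so the observation is kept.\<close>
          with elim False abs_noise[of \<omega>] have "\<bar>X \<omega> + \<sigma> * Z \<omega>\<bar> > \<mu> / 2" by linarith
          with nz show ?thesis
            unfolding loss_def hard_threshold_loss thr sig_def by simp
        qed
        then show ?thesis using err_nonneg[of \<omega>] by simp
      qed
    qed
  qed (use int_sig int_err in auto)
  also have "\<dots> = \<epsilon> * \<sigma>\<^sup>2 + expectation err"
    using int_sig int_err E_sig by simp
  finally have "opt_risk \<sigma> \<le> \<epsilon> * \<sigma>\<^sup>2 + expectation err"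
    using opt_risk_le[of "\<mu>\<^sup>2 / 8" \<sigma>] by simp
  moreover have "\<epsilon> * \<sigma>\<^sup>2 - expectation err \<le> opt_risk \<sigma>"
    unfolding opt_risk_def
  proof (rule cINF_greatest)
    fix l :: real assume l: "l \<in> {0..}"
    have "\<epsilon> * \<sigma>\<^sup>2 - expectation err = expectation (\<lambda>\<omega>. sig \<omega> - err \<omega>)"
      using int_sig int_err E_sig by simp
    also have "\<dots> \<le> risk \<sigma> l"
      unfolding risk_def loss_def[symmetric]
    proof (rule integral_mono_AE)
      show "integrable M (loss l)" unfolding loss_def by (rule integrable_loss)
      show "AE \<omega> in M. sig \<omega> - err \<omega> \<le> loss l \<omega>"
        using X_gap
      proof eventually_elim
        case (elim \<omega>)
        have loss_nonneg: "0 \<le> loss l \<omega>" by (simp add: loss_def)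
        show ?case
        proof (cases "\<mu> / 2 \<le> \<sigma> * \<bar>Z \<omega>\<bar>")
          case True
          have "sig \<omega> \<le> (\<sigma> * Z \<omega>)\<^sup>2 + (X \<omega>)\<^sup>2" by (simp add: sig_def)
          then show ?thesis using tail[OF True] loss_nonneg by linarith
        next
          case False
          have "sig \<omega> \<le> loss l \<omega>"
          proof (cases "X \<omega> = 0")
            case True
            then show ?thesis using loss_nonneg by (simp add: sig_def)
          next
            case nz: False
            \<comment> \<open>Off the tail event the noise is smaller than a nonzero signal, so
              keeping is the cheaper alternative and neither branch of the loss falls below
              \<open>sig\<close>.\<close>
            with elim False \<mu>_pos abs_noise[of \<omega>] have "\<bar>\<sigma> * Z \<omega>\<bar> \<le> \<bar>X \<omega>\<bar>" by auto
            then have "(\<sigma> * Z \<omega>)\<^sup>2 \<le> (X \<omega>)\<^sup>2" by (simp only: abs_le_square_iff)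
            then show ?thesis unfolding loss_def hard_threshold_loss sig_def by simp
          qed
          then show ?thesis using err_nonneg[of \<omega>] by simp
        qed
      qed
    qed (use int_sig int_err in auto)
    finally show "\<epsilon> * \<sigma>\<^sup>2 - expectation err \<le> risk \<sigma> l" .
  qed auto
  ultimately show ?thesis unfolding E_err by linarith
qed

subsection \<open>Continuity of the optimal risk\<close>

lemma integrable_density_times_loss:
  assumes "0 < \<sigma>"
  shows "integrable lborel (\<lambda>w. normal_density 0 \<sigma> w * (hard_threshold (x + w) l - x)\<^sup>2)"
proof (rule Bochner_Integration.integrable_bound)
  show "integrable lborel (\<lambda>w. normal_density 0 \<sigma> w * (w\<^sup>2 + x\<^sup>2))"
    by (rule integrable_normal_density_second_moment[OF assms])
  show "AE w in lborel. norm (normal_density 0 \<sigma> w * (hard_threshold (x + w) l - x)\<^sup>2)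
      \<le> norm (normal_density 0 \<sigma> w * (w\<^sup>2 + x\<^sup>2))"
    by (intro AE_I2) (auto simp: abs_mult intro!: mult_left_mono hard_threshold_loss_le)
qed measurable

text \<open>Fubini for the joint law of \<open>X\<close> and the scaled noise. The noise scale now
  enters through the smooth density alone, not through the argument of the discontinuous threshold
  function.\<close>

lemma risk_eq_density:
  assumes \<sigma>: "0 < \<sigma>"
  defines "r x l \<equiv> \<integral>w. normal_density 0 \<sigma> w * (hard_threshold (x + w) l - x)\<^sup>2 \<partial>lborel"
  shows "integrable M (\<lambda>\<omega>. r (X \<omega>) l)" and "risk \<sigma> l = expectation (\<lambda>\<omega>. r (X \<omega>) l)"
proof -
  define W where "W \<omega> = \<sigma> * Z \<omega>" for \<omega>
  have W_dist: "distributed M lborel W (normal_density 0 \<sigma>)"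
    using normal_density_affine[OF Z_dist, of \<sigma> 0] \<sigma> by (simp add: W_def[abs_def])
  have [measurable]: "random_variable borel W"
    by (simp add: W_def[abs_def])
  have DW: "distr M borel W = density lborel (normal_density 0 \<sigma>)"
    using distributed_distr_eq_density[OF W_dist] by (simp cong: distr_cong)
  have "indep_var borel X borel W"
    using indep_var_compose[OF indep, of "\<lambda>x. x" borel "\<lambda>z. \<sigma> * z" borel]
    by (simp add: comp_def W_def[abs_def])
  \<comment> \<open>Independence in the form needed for Fubini: the joint law is the product of the
    marginals.\<close>
  then have joint: "distr M borel X \<Otimes>\<^sub>M distr M borel W = distr M (borel \<Otimes>\<^sub>M borel) (\<lambda>\<omega>. (X \<omega>, W \<omega>))"
    by (simp add: indep_var_distribution_eq)
  interpret DX: prob_space "distr M borel X" by (rule prob_space_distr) simp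
  interpret DW: prob_space "distr M borel W" by (rule prob_space_distr) simp
  interpret pair_sigma_finite "distr M borel X" "distr M borel W" ..
  define F where "F = (\<lambda>p::real \<times> real. (hard_threshold (fst p + snd p) l - fst p)\<^sup>2)"
  have F_meas [measurable]: "F \<in> borel_measurable (borel \<Otimes>\<^sub>M borel)"
    unfolding F_def by measurable
  have intF: "integrable (distr M borel X \<Otimes>\<^sub>M distr M borel W) F"
    unfolding joint
    by (subst integrable_distr_eq) (use integrable_loss[of \<sigma> l] in \<open>auto simp: F_def W_def\<close>)
  have inner: "(\<integral>w. F (x, w) \<partial>distr M borel W) = r x l" for x
    unfolding DW r_def by (subst integral_real_density) (auto simp: F_def)
  have "integrable (distr M borel X) (\<lambda>x. r x l)"
    using integrable_fst'[OF intF] unfolding inner .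
  then show "integrable M (\<lambda>\<omega>. r (X \<omega>) l)"
    by (rule integrable_distr[rotated]) simp
  have r_meas: "(\<lambda>x. r x l) \<in> borel_measurable borel"
    using borel_measurable_integrable[OF \<open>integrable (distr M borel X) (\<lambda>x. r x l)\<close>] by simp
  have "risk \<sigma> l = (\<integral>p. F p \<partial>distr M (borel \<Otimes>\<^sub>M borel) (\<lambda>\<omega>. (X \<omega>, W \<omega>)))"
    by (subst integral_distr) (auto simp: risk_def F_def W_def)
  also have "\<dots> = (\<integral>x. r x l \<partial>distr M borel X)"
    using integral_fst'[OF intF] by (simp add: joint inner)
  also have "\<dots> = expectation (\<lambda>\<omega>. r (X \<omega>) l)"
    using r_meas by (subst integral_distr) auto
  finally show "risk \<sigma> l = expectation (\<lambda>\<omega>. r (X \<omega>) l)" .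
qed

text \<open>The loss is at most \<open>w\<^sup>2 + x\<^sup>2\<close> whatever the threshold, so the
  change of density is paid for by a term free of \<open>l\<close>. This uniformity lets the
  estimate pass to the infimum.\<close>

lemma risk_diff_le:
  assumes "0 < s" "0 < \<sigma>"
  shows "risk s l \<le> risk \<sigma> l +
    (\<integral>w. \<bar>normal_density 0 s w - normal_density 0 \<sigma> w\<bar> * (w\<^sup>2 + expectation (\<lambda>\<omega>. (X \<omega>)\<^sup>2)) \<partial>lborel)"
proof -
  define D where "D w = \<bar>normal_density 0 s w - normal_density 0 \<sigma> w\<bar>" for w
  define A where "A = (\<integral>w. D w \<partial>lborel)"
  define B where "B = (\<integral>w. D w * w\<^sup>2 \<partial>lborel)"
  define r where "r v x = (\<integral>w. normal_density 0 v w * (hard_threshold (x + w) l - x)\<^sup>2 \<partial>lborel)" for v x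
  have intD: "integrable lborel D"
    unfolding D_def using assms by (intro integrable_abs Bochner_Integration.integrable_diff) auto
  have intD2: "integrable lborel (\<lambda>w. D w * w\<^sup>2)"
  proof -
    have "integrable lborel (\<lambda>w. \<bar>normal_density 0 s w * w\<^sup>2 - normal_density 0 \<sigma> w * w\<^sup>2\<bar>)"
      using integrable_normal_moment[OF assms(1), of 0 2] integrable_normal_moment[OF assms(2), of 0 2]
      by (intro integrable_abs Bochner_Integration.integrable_diff) auto
    then show ?thesis
      by (simp add: D_def left_diff_distrib[symmetric] abs_mult)
  qed
  \<comment> \<open>The weighted integral is affine in \<open>c\<close>. Averaging it at
    \<open>c = x\<^sup>2\<close> over the law of \<open>X\<close> therefore amounts to inserting the
    second moment of \<open>X\<close>.\<close>
  have split: "(\<integral>w. D w * (w\<^sup>2 + c) \<partial>lborel) = B + A * c" for c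
    using intD intD2 by (simp add: distrib_left A_def B_def)
  have r_le: "r s x \<le> r \<sigma> x + (B + A * x\<^sup>2)" for x
  proof -
    have "r s x \<le> (\<integral>w. normal_density 0 \<sigma> w * (hard_threshold (x + w) l - x)\<^sup>2
        + D w * (w\<^sup>2 + x\<^sup>2) \<partial>lborel)"
      unfolding r_def
    proof (rule integral_mono)
      fix w
      have "(normal_density 0 s w - normal_density 0 \<sigma> w) * (hard_threshold (x + w) l - x)\<^sup>2
          \<le> D w * (w\<^sup>2 + x\<^sup>2)"
        by (intro mult_mono hard_threshold_loss_le) (auto simp: D_def)
      then show "normal_density 0 s w * (hard_threshold (x + w) l - x)\<^sup>2
          \<le> normal_density 0 \<sigma> w * (hard_threshold (x + w) l - x)\<^sup>2 + D w * (w\<^sup>2 + x\<^sup>2)"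
        by (simp add: left_diff_distrib)
    qed (use intD intD2 assms in \<open>auto simp: distrib_left intro!: Bochner_Integration.integrable_add
        integrable_density_times_loss\<close>)
    also have "\<dots> = r \<sigma> x + (\<integral>w. D w * (w\<^sup>2 + x\<^sup>2) \<partial>lborel)"
      unfolding r_def using intD intD2 assms
      by (intro Bochner_Integration.integral_add integrable_density_times_loss)
         (auto simp: distrib_left)
    finally show ?thesis unfolding split .
  qed
  have "risk s l = expectation (\<lambda>\<omega>. r s (X \<omega>))"
    unfolding r_def by (rule risk_eq_density(2)[OF assms(1)])
  also have "\<dots> \<le> expectation (\<lambda>\<omega>. r \<sigma> (X \<omega>) + (B + A * (X \<omega>)\<^sup>2))"
    using risk_eq_density(1)[OF assms(1), of l] risk_eq_density(1)[OF assms(2), of l] X_sq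
    by (intro integral_mono r_le) (auto simp: r_def)
  also have "\<dots> = expectation (\<lambda>\<omega>. r \<sigma> (X \<omega>)) + (B + A * expectation (\<lambda>\<omega>. (X \<omega>)\<^sup>2))"
    using risk_eq_density(1)[OF assms(2), of l] X_sq by (simp add: r_def prob_space)
  also have "expectation (\<lambda>\<omega>. r \<sigma> (X \<omega>)) = risk \<sigma> l"
    unfolding r_def by (rule risk_eq_density(2)[OF assms(2), symmetric])
  finally show ?thesis unfolding split[symmetric] D_def .
qed

text \<open>The uniform risk bound, used once in each direction, controls the difference of the two
  infima by a weighted L1 distance of densities. The interval stays away from 0, where the density
  degenerates.\<close>

lemma continuous_on_opt_risk:
  assumes a: "0 < a"
  shows "continuous_on {a..b} opt_risk"
  unfolding continuous_on_sequentially
proof (intro allI ballI impI, elim conjE)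
  fix v :: "nat \<Rightarrow> real" and s
  assume s: "s \<in> {a..b}" and v: "\<forall>n. v n \<in> {a..b}" and lim: "v \<longlonglongrightarrow> s"
  define m where "m = expectation (\<lambda>\<omega>. (X \<omega>)\<^sup>2)"
  define d where "d n = (\<integral>w. \<bar>normal_density 0 (v n) w - normal_density 0 s w\<bar> * (w\<^sup>2 + m) \<partial>lborel)" for n
  have d_sym: "d n = (\<integral>w. \<bar>normal_density 0 s w - normal_density 0 (v n) w\<bar> * (w\<^sup>2 + m) \<partial>lborel)" for n
    unfolding d_def by (simp only: abs_minus_commute)
  have pos: "0 < s" "0 < v n" for n
    using s v a by (auto intro: less_le_trans)
  have lim_d: "d \<longlonglongrightarrow> 0"
    unfolding d_def using v
    by (intro tendsto_normal_density_weighted_L1[OF a s _ lim]) (auto simp: m_def)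
  have "norm (opt_risk (v n) - opt_risk s) \<le> d n" for n
  proof -
    have "opt_risk (v n) \<le> opt_risk s + d n"
      unfolding opt_risk_def d_def m_def
      by (intro INF_le_INF_plus bdd_below_risk risk_diff_le pos) auto
    moreover have "opt_risk s \<le> opt_risk (v n) + d n"
      unfolding opt_risk_def d_sym m_def
      by (intro INF_le_INF_plus bdd_below_risk risk_diff_le pos) auto
    ultimately show ?thesis by (simp add: abs_le_iff)
  qed
  then have "(\<lambda>n. opt_risk (v n) - opt_risk s) \<longlonglongrightarrow> 0"
    by (intro Lim_null_comparison[OF _ lim_d] always_eventually allI)
  then show "(opt_risk \<circ> v) \<longlonglongrightarrow> opt_risk s"
    by (simp add: LIM_zero_iff comp_def)
qed

subsection \<open>The lowest fixed point\<close>

text \<open>To leading order the fixed point equation is linear in the variance. The fixed point is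
  first confined to \<open>{x..b}\<close>, where the risk error is exponentially small, and then the
  linear equation is solved. \<open>K\<close> may depend on \<open>t\<close>, but not on
  \<open>\<sigma>w\<close>.\<close>

lemma lowest_fixed_point_estimate:
  assumes \<delta>: "0 < \<epsilon>" "\<epsilon> < \<delta>" "\<delta> < 1" and t: "0 < t" "t < 1"
  obtains K where "\<forall>\<^sub>F \<sigma>w in at_right 0.
    \<bar>(lowest_fixed_point (state_evolution M X Z \<delta> \<sigma>w))\<^sup>2 - \<delta> / (\<delta> - \<epsilon>) * \<sigma>w\<^sup>2\<bar>
      \<le> K * exp (- (t\<^sup>2 * \<mu>\<^sup>2 * (\<delta> - \<epsilon>) / (8 * \<delta>)) / \<sigma>w\<^sup>2)"
proof -
  \<comment> \<open>The linearised equation has solution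
    \<open>\<delta> / (\<delta> - \<epsilon>) * x\<^sup>2\<close>; dividing by \<open>t < 1\<close>
    leaves room above it for the error term.\<close>
  define c where "c = \<delta> / ((\<delta> - \<epsilon>) * t)"
  \<comment> \<open>The error exponent at variance \<open>c * x\<^sup>2\<close>. One factor
    \<open>t\<close> comes from the Chernoff bound, the other from \<open>c\<close>.\<close>
  define q where "q = t\<^sup>2 * \<mu>\<^sup>2 * (\<delta> - \<epsilon>) / (8 * \<delta>)"
  define K where "K = expectation (chernoff_weight t)"
  have q: "q > 0" using assms \<mu>_pos by (simp add: q_def)
  have c: "c > 1"
  proof -
    have "(\<delta> - \<epsilon>) * t \<le> \<delta> - \<epsilon>" using assms by (intro mult_left_le) auto
    also have "\<dots> < \<delta>" using assms by simp
    finally have "(\<delta> - \<epsilon>) * t < \<delta>" .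
    then show ?thesis using assms by (simp add: c_def)
  qed
  have K: "K \<ge> 0" unfolding K_def by (simp add: chernoff_weight_nonneg)
  have exponent: "- t * \<mu>\<^sup>2 / (8 * (c * x\<^sup>2)) = - q / x\<^sup>2" for x :: real
  proof -
    have "t * \<mu>\<^sup>2 / (8 * (c * x\<^sup>2)) = q / x\<^sup>2"
      using assms by (simp add: c_def q_def power2_eq_square field_simps)
    then show ?thesis by (simp only: mult_minus_left minus_divide_left[symmetric])
  qed
  \<comment> \<open>The slack of the linear part at variance \<open>c * x\<^sup>2\<close>, in units
    of \<open>x\<^sup>2\<close>; it equals \<open>1 - 1 / t\<close>.\<close>
  have gap: "1 + \<epsilon> / \<delta> * c - c < 0"
  proof -
    have "1 + \<epsilon> / \<delta> * c - c = 1 - c * (\<delta> - \<epsilon>) / \<delta>"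
      using assms by (simp add: field_simps)
    also have "c * (\<delta> - \<epsilon>) / \<delta> = 1 / t"
      using assms by (simp add: c_def)
    finally have "1 + \<epsilon> / \<delta> * c - c = 1 - 1 / t" .
    moreover have "1 < 1 / t" using t by simp
    ultimately show ?thesis by linarith
  qed
  have "\<forall>\<^sub>F \<sigma>w in at_right 0. \<bar>(lowest_fixed_point (state_evolution M X Z \<delta> \<sigma>w))\<^sup>2 - \<delta> / (\<delta> - \<epsilon>) * \<sigma>w\<^sup>2\<bar>
      \<le> K / (\<delta> - \<epsilon>) * exp (- q / \<sigma>w\<^sup>2)"
  proof -
    \<comment> \<open>The exponential error is negligible even relative to \<open>x\<^sup>2\<close>,
      so the slack eventually absorbs it.\<close>
    have "((\<lambda>x. K / \<delta> * exp (- q / x\<^sup>2) / x\<^sup>2) \<longlongrightarrow> 0) (at_right 0)"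
      using q by real_asymp
    from order_tendstoD(2)[OF this, of "- (1 + \<epsilon> / \<delta> * c - c)"] gap
    have "\<forall>\<^sub>F x in at_right 0. K / \<delta> * exp (- q / x\<^sup>2) / x\<^sup>2 < - (1 + \<epsilon> / \<delta> * c - c)"
      by simp
    \<comment> \<open>This keeps \<open>b = sqrt c * x\<close> at most 1, within the range of the
      risk estimate.\<close>
    moreover have "\<forall>\<^sub>F x in at_right (0::real). 0 < x \<and> x < 1 / sqrt c"
      using c eventually_at_right_real[of 0 "1 / sqrt c"] by simp
    ultimately show ?thesis
    proof eventually_elim
      case (elim x)
      define \<Psi> where "\<Psi> = state_evolution M X Z \<delta> x"
      define b where "b = sqrt c * x"
      define p where "p = lowest_fixed_point \<Psi>"
      have x: "0 < x" and b: "b \<le> 1" "x \<le> b" "b\<^sup>2 = c * x\<^sup>2"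
        using elim c by (auto simp: b_def field_simps power_mult_distrib)
      have \<Psi>: "\<Psi> (\<sigma>\<^sup>2) = x\<^sup>2 + 1 / \<delta> * opt_risk \<sigma>" if "0 \<le> \<sigma>" for \<sigma>
        unfolding \<Psi>_def using that by (rule state_evolution_eq)
      have \<Psi>_ge: "\<Psi> (\<sigma>\<^sup>2) \<ge> x\<^sup>2" if "0 \<le> \<sigma>" for \<sigma>
        using \<Psi>[OF that] opt_risk_nonneg[of \<sigma>] \<delta> by simp
      have "continuous_on {x..b} (\<lambda>\<sigma>. x\<^sup>2 + 1 / \<delta> * opt_risk \<sigma> - \<sigma>\<^sup>2)"
        by (intro continuous_intros continuous_on_opt_risk x)
      then have cont: "continuous_on {x..b} (\<lambda>\<sigma>. \<Psi> (\<sigma>\<^sup>2) - \<sigma>\<^sup>2)"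
        by (rule continuous_on_eq) (use x in \<open>auto simp: \<Psi>\<close>)
      have risk_est: "\<bar>opt_risk \<sigma> - \<epsilon> * \<sigma>\<^sup>2\<bar> \<le> K * exp (- t * \<mu>\<^sup>2 / (8 * \<sigma>\<^sup>2))"
        if "0 < \<sigma>" "\<sigma> \<le> 1" for \<sigma>
        unfolding K_def using t that by (intro opt_risk_estimate) auto
      have "\<bar>opt_risk b - \<epsilon> * b\<^sup>2\<bar> \<le> K * exp (- q / x\<^sup>2)"
        unfolding exponent[symmetric] b(3)[symmetric] using b x by (intro risk_est) auto
      then have "opt_risk b \<le> \<epsilon> * b\<^sup>2 + K * exp (- q / x\<^sup>2)"
        by linarith
      then have "1 / \<delta> * opt_risk b \<le> 1 / \<delta> * (\<epsilon> * b\<^sup>2 + K * exp (- q / x\<^sup>2))"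
        using \<delta> by (intro mult_left_mono) auto
      moreover have "K / \<delta> * exp (- q / x\<^sup>2) \<le> - (1 + \<epsilon> / \<delta> * c - c) * x\<^sup>2"
        using elim(1) pos_divide_less_eq[OF zero_less_power[OF x, of 2]] by (intro less_imp_le) blast
      ultimately have "x\<^sup>2 + 1 / \<delta> * opt_risk b \<le> c * x\<^sup>2"
        unfolding b(3) by (simp add: algebra_simps)
      then have top: "\<Psi> (b\<^sup>2) \<le> b\<^sup>2"
        using \<Psi>[of b] b x by simp
      \<comment> \<open>The noise floor \<open>x\<^sup>2\<close> bounds \<open>\<Psi>\<close> from
        below, which rules out fixed points under \<open>x\<close>.\<close>
      have below: "\<Psi> (\<sigma>\<^sup>2) > \<sigma>\<^sup>2" if "0 \<le> \<sigma>" "\<sigma> < x" for \<sigma>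
        using \<Psi>_ge[OF that(1)] power_strict_mono[OF that(2,1), of 2] by simp
      have p: "p \<in> {x..b}" "\<Psi> (p\<^sup>2) = p\<^sup>2"
        using lowest_fixed_pointI[OF cont _ b(2) top below \<Psi>_ge] x unfolding p_def by auto
      then have p01: "0 < p" "p \<le> 1" using x b by auto
      have "p\<^sup>2 \<le> c * x\<^sup>2"
        using p p01 power_mono[of p b 2] b(3) by simp
      \<comment> \<open>The error bound increases with the noise scale, so its value at
        \<open>b\<close> also serves at \<open>p\<close>.\<close>
      then have "t * \<mu>\<^sup>2 / (8 * (c * x\<^sup>2)) \<le> t * \<mu>\<^sup>2 / (8 * p\<^sup>2)"
        using t p01 c x by (intro divide_left_mono) auto
      then have "K * exp (- t * \<mu>\<^sup>2 / (8 * p\<^sup>2)) \<le> K * exp (- q / x\<^sup>2)"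
        unfolding exponent[symmetric] using K by (intro mult_left_mono) auto
      then have est: "\<bar>opt_risk p - \<epsilon> * p\<^sup>2\<bar> \<le> K * exp (- q / x\<^sup>2)"
        using risk_est[OF p01] by linarith
      have "opt_risk p = \<delta> * (p\<^sup>2 - x\<^sup>2)"
        using p(2) \<Psi>[of p] p01 \<delta> by (simp add: field_simps)
      \<comment> \<open>The fixed point equation solved for the variance: the deviation from the
        leading term is exactly the scaled error of the risk.\<close>
      then have "p\<^sup>2 - \<delta> / (\<delta> - \<epsilon>) * x\<^sup>2 = (opt_risk p - \<epsilon> * p\<^sup>2) / (\<delta> - \<epsilon>)"
        using \<delta> by (simp add: field_simps)
      then have "\<bar>p\<^sup>2 - \<delta> / (\<delta> - \<epsilon>) * x\<^sup>2\<bar> = \<bar>opt_risk p - \<epsilon> * p\<^sup>2\<bar> / (\<delta> - \<epsilon>)"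
        using \<delta> by simp
      also have "\<dots> \<le> K * exp (- q / x\<^sup>2) / (\<delta> - \<epsilon>)"
        using est \<delta> by (intro divide_right_mono) auto
      finally show ?case unfolding p_def \<Psi>_def by simp
    qed
  qed
  then show ?thesis
    by (intro that[of "K / (\<delta> - \<epsilon>)"]) (simp add: q_def)
qed

text \<open>The exponential rate \<open>q\<close> tends to \<open>L\<^sup>2 / 2\<close> as
  \<open>t\<close> approaches 1, and the Gaussian density has rate
  \<open>\<mu>bar\<^sup>2 / 2\<close>. Since \<open>\<mu>bar < L\<close>, some \<open>t < 1\<close>
  makes the error decay strictly faster.\<close>

lemma lowest_fixed_point_asymp:
  assumes \<delta>: "0 < \<epsilon>" "\<epsilon> < \<delta>" "\<delta> < 1" and \<mu>bar: "0 < \<mu>bar" "\<mu>bar < \<mu> / 2 * sqrt ((\<delta> - \<epsilon>) / \<delta>)"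
  shows "(\<lambda>\<sigma>w. (lowest_fixed_point (state_evolution M X Z \<delta> \<sigma>w))\<^sup>2 - \<delta> / (\<delta> - \<epsilon>) * \<sigma>w\<^sup>2)
           \<in> o[at_right 0](\<lambda>\<sigma>w. std_normal_density (\<mu>bar / \<sigma>w))"
proof -
  define L where "L = \<mu> / 2 * sqrt ((\<delta> - \<epsilon>) / \<delta>)"
  have L: "0 < L" "\<mu>bar / L < 1" using \<mu>bar by (auto simp: L_def)
  obtain t where t: "\<mu>bar / L < t" "t < 1" using dense[OF L(2)] by blast
  have t0: "0 < t" using t(1) L(1) \<mu>bar(1) by (meson divide_pos_pos less_trans)
  define q where "q = t\<^sup>2 * \<mu>\<^sup>2 * (\<delta> - \<epsilon>) / (8 * \<delta>)"
  have "\<mu>bar\<^sup>2 < (t * L)\<^sup>2"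
    using t(1) L \<mu>bar(1) by (intro power_strict_mono) (auto simp: field_simps)
  also have "(t * L)\<^sup>2 = 2 * q"
    using \<delta> by (simp add: L_def q_def power_mult_distrib power_divide field_simps)
  finally have q: "\<mu>bar\<^sup>2 < 2 * q" .
  obtain K where K: "\<forall>\<^sub>F \<sigma>w in at_right 0.
    \<bar>(lowest_fixed_point (state_evolution M X Z \<delta> \<sigma>w))\<^sup>2 - \<delta> / (\<delta> - \<epsilon>) * \<sigma>w\<^sup>2\<bar>
      \<le> K * exp (- q / \<sigma>w\<^sup>2)"
    using lowest_fixed_point_estimate[OF \<delta> t0 t(2)] unfolding q_def by blast
  have "(\<lambda>\<sigma>w. (lowest_fixed_point (state_evolution M X Z \<delta> \<sigma>w))\<^sup>2 - \<delta> / (\<delta> - \<epsilon>) * \<sigma>w\<^sup>2)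
      \<in> O[at_right 0](\<lambda>\<sigma>w. exp (- q / \<sigma>w\<^sup>2))"
    \<comment> \<open>The witness is \<open>\<bar>K\<bar> + 1\<close> because the constant has to be
      positive.\<close>
    by (rule landau_o.bigI[of "\<bar>K\<bar> + 1"])
       (auto intro!: eventually_mono[OF K] elim!: order_trans mult_right_mono)
  also have "(\<lambda>\<sigma>w. exp (- q / \<sigma>w\<^sup>2)) \<in> o[at_right 0](\<lambda>\<sigma>w. std_normal_density (\<mu>bar / \<sigma>w))"
  proof (rule smalloI_tendsto)
    \<comment> \<open>The margin between the two exponential rates; the quotient is a constant times
      \<open>exp (- d / x\<^sup>2)\<close>.\<close>
    define d where "d = q - \<mu>bar\<^sup>2 / 2"
    have "d > 0" using q by (simp add: d_def)
    then have "((\<lambda>x. sqrt (2 * pi) * exp (- d / x\<^sup>2)) \<longlongrightarrow> 0) (at_right 0)"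
      by real_asymp
    moreover have "sqrt (2 * pi) * exp (- d / x\<^sup>2) = exp (- q / x\<^sup>2) / std_normal_density (\<mu>bar / x)" for x
    proof -
      have "- d / x\<^sup>2 = - q / x\<^sup>2 - - (\<mu>bar / x)\<^sup>2 / 2"
        by (simp add: d_def power_divide diff_divide_distrib)
      then have "exp (- d / x\<^sup>2) = exp (- q / x\<^sup>2) / exp (- (\<mu>bar / x)\<^sup>2 / 2)"
        by (simp only: exp_diff)
      then show ?thesis
        unfolding std_normal_density_def by (simp only:) simp
    qed
    ultimately show "((\<lambda>x. exp (- q / x\<^sup>2) / std_normal_density (\<mu>bar / x)) \<longlongrightarrow> 0) (at_right 0)"
      by simp
    show "\<forall>\<^sub>F x in at_right 0. std_normal_density (\<mu>bar / x) \<noteq> 0"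
      by (simp add: std_normal_density_def)
  qed
  finally show ?thesis .
qed

end

section \<open>Integration against the mixture and reduction of the theorem to the channel\<close>

lemma nn_integral_point_mass_mixture:
  assumes [measurable_cong]: "sets G = sets borel" and [measurable]: "f \<in> borel_measurable borel"
  shows "(\<integral>\<^sup>+x. f x \<partial>point_mass_mixture \<epsilon> G) = ennreal (1 - \<epsilon>) * f 0 + ennreal \<epsilon> * (\<integral>\<^sup>+x. f x \<partial>G)"
  using assms(2)
proof (induction rule: borel_measurable_induct)
  case (cong f g)
  then show ?case by (simp cong: nn_integral_cong)
next
  case (set A)
  then show ?case
    using assms(1) by (simp add: emeasure_point_mass_mixture[OF assms(1)])
next
  case (mult u c)
  have [measurable]: "u \<in> borel_measurable (point_mass_mixture \<epsilon> G)" "u \<in> borel_measurable G"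
    using mult by (auto cong: measurable_cong_sets simp: measurable_cong_sets[OF assms(1) refl])
  show ?case
    using mult by (simp add: nn_integral_cmult algebra_simps)
next
  case (add u v)
  have [measurable]: "u \<in> borel_measurable (point_mass_mixture \<epsilon> G)" "u \<in> borel_measurable G"
      "v \<in> borel_measurable (point_mass_mixture \<epsilon> G)" "v \<in> borel_measurable G"
    using add by (auto cong: measurable_cong_sets simp: measurable_cong_sets[OF assms(1) refl])
  show ?case
    using add by (simp add: nn_integral_add algebra_simps)
next
  case (seq u)
  have [measurable]: "u i \<in> borel_measurable (point_mass_mixture \<epsilon> G)" "u i \<in> borel_measurable G" for i
    using seq by (auto simp: measurable_cong_sets[OF assms(1) refl]
        measurable_cong_sets[OF sets_point_mass_mixture refl])
  \<comment> \<open>Both summands increase with \<open>i\<close>, which is what allows the supremum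
    of the sum to be split.\<close>
  have mono: "incseq (\<lambda>i. ennreal (1 - \<epsilon>) * u i 0)" "incseq (\<lambda>i. ennreal \<epsilon> * (\<integral>\<^sup>+x. u i x \<partial>G))"
    using seq(3) by (auto simp: incseq_def le_fun_def intro!: mult_left_mono nn_integral_mono)
  have "(\<integral>\<^sup>+x. (SUP i. u i) x \<partial>point_mass_mixture \<epsilon> G)
      = (SUP i. \<integral>\<^sup>+x. u i x \<partial>point_mass_mixture \<epsilon> G)"
    unfolding SUP_apply using seq(3) by (intro nn_integral_monotone_convergence_SUP) auto
  also have "\<dots> = (SUP i. ennreal (1 - \<epsilon>) * u i 0) + (SUP i. ennreal \<epsilon> * (\<integral>\<^sup>+x. u i x \<partial>G))"
    by (simp add: seq ennreal_SUP_add[OF mono])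
  also have "(SUP i. ennreal (1 - \<epsilon>) * u i 0) = ennreal (1 - \<epsilon>) * (SUP i. u i) 0"
    by (simp add: SUP_mult_left_ennreal SUP_apply image_comp)
  also have "(SUP i. ennreal \<epsilon> * (\<integral>\<^sup>+x. u i x \<partial>G)) = ennreal \<epsilon> * (\<integral>\<^sup>+x. (SUP i. u i) x \<partial>G)"
    unfolding SUP_apply SUP_mult_left_ennreal[symmetric] using seq(3)
    by (subst nn_integral_monotone_convergence_SUP) auto
  finally show ?case .
qed

theorem theorem9:
  fixes M :: "'a measure" and N :: "'b measure" and G :: "real measure"
    and X Z :: "'a \<Rightarrow> real" and U :: "'b \<Rightarrow> real"
    and \<delta> \<epsilon> \<mu> \<mu>bar :: real
  assumes "0 < \<delta>" "\<delta> < 1" "0 < \<epsilon>" "\<epsilon> < 1" "\<epsilon> < \<delta>"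
    and "prob_space G" "sets G = sets borel"
    and "prob_space M"
    and "X \<in> borel_measurable M" "distr M borel X = point_mass_mixture \<epsilon> G"
    and "distributed M lborel Z std_normal_density"
    and "prob_space.indep_var M borel X borel Z"
    and "prob_space N"
    and "U \<in> borel_measurable N" "distr N borel U = G"
    and "integrable N (\<lambda>\<omega>. \<bar>U \<omega>\<bar>\<^sup>2)"
    and "\<mu> = Sup {v. \<P>(\<omega> in N. \<bar>U \<omega>\<bar> > v) = 1}" "\<mu> > 0"
    and "\<P>(\<omega> in N. \<bar>U \<omega>\<bar> > \<mu>) = 1"
    and "0 < \<mu>bar" "\<mu>bar < \<mu> / 2 * sqrt ((\<delta> - \<epsilon>) / \<delta>)"
  shows "(\<lambda>\<sigma>w. (lowest_fixed_point (state_evolution M X Z \<delta> \<sigma>w))\<^sup>2 - \<delta> / (\<delta> - \<epsilon>) * \<sigma>w\<^sup>2)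
           \<in> o[at_right 0](\<lambda>\<sigma>w. std_normal_density (\<mu>bar / \<sigma>w))"
proof -
  interpret M: prob_space M by fact
  interpret N: prob_space N by fact
  interpret G: prob_space G by fact
  note G_sets [measurable_cong] = \<open>sets G = sets borel\<close>
  note [measurable] = \<open>X \<in> borel_measurable M\<close> \<open>U \<in> borel_measurable N\<close>
  have G_space: "space G = UNIV"
    using sets_eq_imp_space_eq[OF G_sets] by simp
  have "AE \<omega> in N. \<bar>U \<omega>\<bar> > \<mu>"
    using \<open>\<P>(\<omega> in N. \<bar>U \<omega>\<bar> > \<mu>) = 1\<close> by (subst (asm) N.prob_Collect_eq_1) auto
  then have "AE u in distr N borel U. \<bar>u\<bar> > \<mu>"
    by (subst AE_distr_iff) auto
  then have G_gap: "AE u in G. \<bar>u\<bar> > \<mu>"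
    unfolding \<open>distr N borel U = G\<close> .
  \<comment> \<open>The law of \<open>X\<close> in terms of \<open>G\<close>; evaluated below on two
    sets that omit 0, so that only the part from \<open>G\<close> survives.\<close>
  have mix: "emeasure M {\<omega> \<in> space M. X \<omega> \<in> A} = ennreal (1 - \<epsilon>) * indicator A 0 + ennreal \<epsilon> * emeasure G A"
    if "A \<in> sets borel" for A
  proof -
    have "emeasure M {\<omega> \<in> space M. X \<omega> \<in> A} = emeasure (distr M borel X) A"
      using that by (simp add: emeasure_distr vimage_def Int_def conj_commute)
    then show ?thesis
      using that \<open>distr M borel X = point_mass_mixture \<epsilon> G\<close> G_sets by (simp add: emeasure_point_mass_mixture)
  qed
  have "integrable G (\<lambda>u. u\<^sup>2)"
    unfolding \<open>distr N borel U = G\<close>[symmetric]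
    using \<open>integrable N (\<lambda>\<omega>. \<bar>U \<omega>\<bar>\<^sup>2)\<close> by (subst integrable_distr_eq) auto
  then have G_sq: "(\<integral>\<^sup>+u. ennreal (u\<^sup>2) \<partial>G) < \<infinity>"
    by (simp add: integrable_iff_bounded)
  interpret channel: sparse_gaussian_channel M X Z \<epsilon> \<mu>
  proof
    show "integrable M (\<lambda>\<omega>. (X \<omega>)\<^sup>2)"
    proof (rule integrableI_bounded)
      have "(\<integral>\<^sup>+\<omega>. ennreal (norm ((X \<omega>)\<^sup>2)) \<partial>M) = (\<integral>\<^sup>+x. ennreal (x\<^sup>2) \<partial>distr M borel X)"
        by (simp add: nn_integral_distr)
      \<comment> \<open>The atom at 0 contributes nothing because the square vanishes there.\<close>
      also have "\<dots> = ennreal \<epsilon> * (\<integral>\<^sup>+u. ennreal (u\<^sup>2) \<partial>G)"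
        using \<open>distr M borel X = point_mass_mixture \<epsilon> G\<close> G_sets by (simp add: nn_integral_point_mass_mixture)
      also have "\<dots> < \<infinity>"
        using G_sq by (simp add: ennreal_mult_less_top)
      finally show "(\<integral>\<^sup>+\<omega>. ennreal (norm ((X \<omega>)\<^sup>2)) \<partial>M) < \<infinity>" .
    qed measurable
    have "AE u in G. u \<notin> {x. \<not> (x = 0 \<or> \<bar>x\<bar> > \<mu>)}"
      using G_gap by eventually_elim auto
    then have "emeasure G {x. \<not> (x = 0 \<or> \<bar>x\<bar> > \<mu>)} = 0"
      by (subst (asm) AE_iff_measurable[OF _ refl]) (auto simp: G_space)
    then have "emeasure M {\<omega> \<in> space M. X \<omega> \<in> {x. \<not> (x = 0 \<or> \<bar>x\<bar> > \<mu>)}} = 0"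
      by (subst mix) auto
    then show "AE \<omega> in M. X \<omega> = 0 \<or> \<bar>X \<omega>\<bar> > \<mu>"
      by (subst AE_iff_measurable[OF _ refl]) auto
    \<comment> \<open>As \<open>\<mu> > 0\<close>, \<open>G\<close> has no mass at 0, so
      \<open>X\<close> is nonzero with probability exactly \<open>\<epsilon>\<close>.\<close>
    have "AE u in G. u \<in> {x. x \<noteq> 0}"
      using G_gap by eventually_elim (use \<open>\<mu> > 0\<close> in auto)
    then have "emeasure G {x. x \<noteq> 0} = 1"
      by (intro G.emeasure_eq_1_AE) measurable
    then have "emeasure M {\<omega> \<in> space M. X \<omega> \<in> {x. x \<noteq> 0}} = ennreal \<epsilon>"
      by (subst mix) auto
    then show "M.prob {\<omega> \<in> space M. X \<omega> \<noteq> 0} = \<epsilon>"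
      using \<open>0 < \<epsilon>\<close> by (simp add: measure_def)
  qed fact+
  show ?thesis
    by (rule channel.lowest_fixed_point_asymp) fact+
qed

end
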